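(* Let $m\ge 1$, let $\varrho=(\varrho_1,\dots,\varrho_m)$ be a vector of non-negative integers, and let $Q_\varrho=\prod_{j=1}^m\{0,1,\dots,\varrho_j\}$. For a subset $\mathcal I\subseteq Q_\varrho$, consider the following properties. (I1) Removals exist in $\mathcal I$ and the following holds. For all $p\in\mathcal I$ and removals $p\setminus i$ and $p\setminus j$ in $\mathcal I$, with $i,j\in\{1,\dots,m\}$, the meet $q:=(p\setminus i)\wedge(p\setminus j)$ belongs to $\mathcal I$ and, moreover, the two intervals $[q,p\setminus i]$ and $[q,p\setminus j]$ in $\mathcal I$ have the same size (number of elements). (I2) (For $\mathcal I$ satisfying (I1), with $|\cdot|$ the size function on $\mathcal I$.) For all $a,b\in\mathcal I$ with $a\prec b$, one has $|a|<|b|$. Moreover, for all $a,b\in\mathcal I$ such that $|a|<|b|$ and $D(a,b)$ contains at least two elements, there exists $c\in\mathcal I$ such that $c\preceq a\vee b$, $|c|>|a|$, and there exists $i\in D(a,b)$ with $c_i<b_i$. (I* ) For every $i\in\{1,\dots,m\}$, the points $t\,e_i$ for $t\in\{0,\dots,\varrho_i\}$ are all in $\mathcal I$. Then the set of independents of a matricube $\mathscr M$ with ground set $Q_\varrho$ satisfies (I1) and (I2). Conversely, if $\mathcal I\subseteq Q_\varrho$ satisfies (I1) and (I2), then $\mathcal I$ is the set of independents of a matricube $\mathscr M$ with ground set $Q_\varrho$. Moreover, the matricube $\mathscr M$ is simple if and only if its set of independents $\mathcal I$ satisfies (I* ).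
   Context: $Q_\varrho$ is ordered coordinatewise: $x\preceq y$ iff $x_j\le y_j$ for all $j$; $x\prec y$ means $x\preceq y$ and $x\ne y$. The operations $\vee$ and $\wedge$ are the coordinatewise maximum and minimum. $e_i$ is the $i$-th unit vector. A matricube $\mathscr M$ with ground set $Q_\varrho$ is given by a function $\mathbf r:Q_\varrho\to\mathbb Z$ (its rank function) such that: (R1) $\mathbf r(0)=0$ and $\mathbf r(t\,e_i)-\mathbf r((t-1)e_i)\le 1$ for all $1\le i\le m$ and $1\le t\le \varrho_i$; (R2) $x\preceq y$ implies $\mathbf r(x)\le\mathbf r(y)$; (R3) $\mathbf r(x)+\mathbf r(y)\ge \mathbf r(x\vee y)+\mathbf r(x\wedge y)$ for all $x,y\in Q_\varrho$. It is simple if $\varrho_i>0$ and $\mathbf r(t\,e_i)=t$ for all $i$ and all $t\in\{0,\dots,\varrho_i\}$. A point $p\in Q_\varrho$ is an independent of $\mathscr M$ if for each $i$ with $p-e_i\in Q_\varrho$ one has $\mathbf r(p-e_i)=\mathbf r(p)-1$. Removals. Let $\mathcal I\subseteq Q_\varrho$, $a\in\mathcal I$ and $i$ with $a_i\ne 0$. If there is at least one element $b\prec a$ in $\mathcal I$ differing from $a$ only in the $i$-th coordinate, then $a\setminus i$ (the removal of $i$ in $a$ in $\mathcal I$) is the one with the largest $i$-th coordinate. Removals exist in $\mathcal I$ if for every $a\in\mathcal I$ and every $i$ with $a_i\ge 1$, the removal $a\setminus i$ exists in $\mathcal I$. The interval $[a,b]$ in $\mathcal I$ is the set of $c\in\mathcal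 I$ with $a\preceq c\preceq b$. Size. If $\mathcal I$ satisfies (I1), then for each $a\in\mathcal I$ all sequences of successive removals in $\mathcal I$ bringing $a$ to $0$ have the same length; this common length is the size $|a|$ of $a$. For $a,b\in Q_\varrho$, $D(a,b)=\{k\in\{1,\dots,m\}: a_k<b_k\}$.
   Formalization: The converse assumes I nonempty (the empty set satisfies (I1), (I2) vacuously, but 0 is always independent), and "simple iff (I* )" becomes "simple iff all ϱ_i > 0 and (I* )" (for ϱ = 0, (I* ) holds but M is not simple). *)

theory Defs
  imports Main
begin

text \<open>
  Coordinates are indexed by a finite type \<open>'n\<close>, so \<open>m = CARD('n) \<ge> 1\<close>.  Points are
  functions \<open>'n \<Rightarrow> nat\<close> with the library's pointwise order; \<open>sup\<close> and \<open>inf\<close> are then the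
  coordinatewise maximum and minimum.
\<close>

definition box :: "('n::finite \<Rightarrow> nat) \<Rightarrow> ('n \<Rightarrow> nat) set" where
  "box \<rho> = {x. \<forall>j. x j \<le> \<rho> j}"

definition axis_point :: "nat \<Rightarrow> 'n::finite \<Rightarrow> ('n \<Rightarrow> nat)" where
  "axis_point t i = (\<lambda>j. if j = i then t else 0)"

definition matricube :: "('n::finite \<Rightarrow> nat) \<Rightarrow> (('n \<Rightarrow> nat) \<Rightarrow> int) \<Rightarrow> bool" where
  "matricube \<rho> r \<longleftrightarrow>
     (r (\<lambda>_. 0) = 0 \<and>
      (\<forall>i t. 1 \<le> t \<and> t \<le> \<rho> i \<longrightarrow> r (axis_point t i) - r (axis_point (t - 1) i) \<le> 1)) \<and>
     (\<forall>x\<in>box \<rho>. \<forall>y\<in>box \<rho>. x \<le> y \<longrightarrow> r x \<le> r y) \<and>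
     (\<forall>x\<in>box \<rho>. \<forall>y\<in>box \<rho>. r x + r y \<ge> r (sup x y) + r (inf x y))"

definition simple_matricube :: "('n::finite \<Rightarrow> nat) \<Rightarrow> (('n \<Rightarrow> nat) \<Rightarrow> int) \<Rightarrow> bool" where
  "simple_matricube \<rho> r \<longleftrightarrow>
     matricube \<rho> r \<and> (\<forall>i. \<rho> i > 0 \<and> (\<forall>t\<le>\<rho> i. r (axis_point t i) = int t))"

text \<open>
  For \<open>p\<close> in the box, \<open>p - e\<^sub>i\<close> lies in the box iff \<open>p i \<ge> 1\<close>; the guard is needed because
  subtraction on \<open>nat\<close> truncates.
\<close>

definition independents ::
    "('n::finite \<Rightarrow> nat) \<Rightarrow> (('n \<Rightarrow> nat) \<Rightarrow> int) \<Rightarrow> ('n \<Rightarrow> nat) set" where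
  "independents \<rho> r =
     {p \<in> box \<rho>. \<forall>i. p i \<ge> 1 \<longrightarrow> r (p(i := p i - 1)) = r p - 1}"

definition lower_in_direction ::
    "('n::finite \<Rightarrow> nat) set \<Rightarrow> ('n \<Rightarrow> nat) \<Rightarrow> 'n \<Rightarrow> ('n \<Rightarrow> nat) set" where
  "lower_in_direction I a i = {b \<in> I. b < a \<and> (\<forall>j. j \<noteq> i \<longrightarrow> b j = a j)}"

text \<open>\<open>is_removal I a i b\<close> says that \<open>a \<setminus> i\<close> exists in \<open>I\<close> and equals \<open>b\<close>.\<close>

definition is_removal ::
    "('n::finite \<Rightarrow> nat) set \<Rightarrow> ('n \<Rightarrow> nat) \<Rightarrow> 'n \<Rightarrow> ('n \<Rightarrow> nat) \<Rightarrow> bool" where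
  "is_removal I a i b \<longleftrightarrow>
     b \<in> lower_in_direction I a i \<and> (\<forall>c\<in>lower_in_direction I a i. c i \<le> b i)"

definition removals_exist :: "('n::finite \<Rightarrow> nat) set \<Rightarrow> bool" where
  "removals_exist I \<longleftrightarrow> (\<forall>a\<in>I. \<forall>i. a i \<ge> 1 \<longrightarrow> (\<exists>b. is_removal I a i b))"

definition interval_in ::
    "('n::finite \<Rightarrow> nat) set \<Rightarrow> ('n \<Rightarrow> nat) \<Rightarrow> ('n \<Rightarrow> nat) \<Rightarrow> ('n \<Rightarrow> nat) set" where
  "interval_in I a b = {c \<in> I. a \<le> c \<and> c \<le> b}"

definition axiom_I1 :: "('n::finite \<Rightarrow> nat) set \<Rightarrow> bool" where
  "axiom_I1 I \<longleftrightarrow>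
     removals_exist I \<and>
     (\<forall>p\<in>I. \<forall>i j u v. is_removal I p i u \<and> is_removal I p j v \<longrightarrow>
        inf u v \<in> I \<and>
        card (interval_in I (inf u v) u) = card (interval_in I (inf u v) v))"

definition removal_rel :: "('n::finite \<Rightarrow> nat) set \<Rightarrow> (('n \<Rightarrow> nat) \<times> ('n \<Rightarrow> nat)) set" where
  "removal_rel I = {(a, b). a \<in> I \<and> (\<exists>i. is_removal I a i b)}"

text \<open>
  The common length of all sequences of removals in \<open>I\<close> from \<open>a\<close> to \<open>0\<close>.  It is meaningful
  only for \<open>a \<in> I\<close> when \<open>I\<close> satisfies \<open>axiom_I1\<close>, and is used only in that situation.
\<close>

definition size_in :: "('n::finite \<Rightarrow> nat) set \<Rightarrow> ('n \<Rightarrow> nat) \<Rightarrow> nat" where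
  "size_in I a = (THE n. (a, \<lambda>_. 0) \<in> removal_rel I ^^ n)"

definition less_coords :: "('n::finite \<Rightarrow> nat) \<Rightarrow> ('n \<Rightarrow> nat) \<Rightarrow> 'n set" where
  "less_coords a b = {k. a k < b k}"

definition axiom_I2 :: "('n::finite \<Rightarrow> nat) set \<Rightarrow> bool" where
  "axiom_I2 I \<longleftrightarrow>
     (\<forall>a\<in>I. \<forall>b\<in>I. a < b \<longrightarrow> size_in I a < size_in I b) \<and>
     (\<forall>a\<in>I. \<forall>b\<in>I. size_in I a < size_in I b \<and> card (less_coords a b) \<ge> 2 \<longrightarrow>
        (\<exists>c\<in>I. c \<le> sup a b \<and> size_in I c > size_in I a \<and>
           (\<exists>i\<in>less_coords a b. c i < b i)))"

definition axiom_Istar :: "('n::finite \<Rightarrow> nat) \<Rightarrow> ('n \<Rightarrow> nat) set \<Rightarrow> bool" where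
  "axiom_Istar \<rho> I \<longleftrightarrow> (\<forall>i. \<forall>t\<le>\<rho> i. axis_point t i \<in> I)"

end

theory Submission
  imports Defs "HOL-Library.FuncSet"
begin

text \<open>
  Write \<open>p - e\<^sub>i\<close> for \<open>p(i := p i - 1)\<close>, and call the points obtained from \<open>p\<close> by
  changing its \<open>i\<close>-th coordinate the fibre of \<open>p\<close> in direction \<open>i\<close>.

  The rank of a matricube rises by \<open>0\<close> or \<open>1\<close> along each unit step, and by submodularity a
  step in a fixed direction, at a fixed height of that coordinate, gains at least as much at a
  lower point (\<open>matricube_diminishing\<close>).  Hence, below an independent point \<open>p\<close>, whether a point of the
  fibre in direction \<open>i\<close> is independent depends only on the unit step below it in direction \<open>i\<close>
  (\<open>independents_fibre_iff\<close>).  So the rank counts the independents along a fibre: each removal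
  lowers the rank by exactly one, the size of an independent is its rank, and both intervals in
  the first axiom have the cardinality predicted by the rank, which gives that axiom.  For the
  exchange part of the second axiom, lower \<open>sup a b\<close> to the height of \<open>a\<close> in one of two coordinates
  of \<open>less_coords a b\<close>; by submodularity one of the two resulting points has rank above that of
  \<open>a\<close>, and an independent of full rank below it is the required \<open>c\<close>.

  Conversely, given \<open>I\<close>, the first axiom is a diamond property with equal lengths for removals, so
  all descents to \<open>0\<close> from a point are equally long (\<open>removal_length_unique\<close>).  Let the rank of \<open>x\<close>
  be the largest size of a member of \<open>I\<close> below \<open>x\<close>.  Monotonicity is immediate, and removals show
  that a unit step gains at most one.  Submodularity reduces to unit squares, where the only way
  to fail is that the two intermediate corners have the rank of the bottom corner while the top
  corner has rank one more.  There the exchange axiom, applied to a largest member below the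
  bottom and a larger member \<open>b\<close> below the top chosen extremal, yields a contradiction
  (\<open>rank_of_local_submodular\<close>).  That the independents of this rank are exactly \<open>I\<close> uses that size
  is strictly monotone on \<open>I\<close>.

  For simplicity, the axis point of height \<open>t\<close> is independent exactly when the last unit step to it
  gains one, and all these steps gain one exactly when the rank on the axis is the height.
\<close>

section \<open>Points of the grid\<close>

lemma finite_points_below: "finite {a :: 'n::finite \<Rightarrow> nat. a \<le> x}"
proof (rule finite_subset)
  show "{a. a \<le> x} \<subseteq> (\<Pi>\<^sub>E i\<in>UNIV. {..x i})"
    by (auto simp: le_fun_def)
qed (simp add: finite_PiE)

lemma coordinate_sum_strict_mono:
  fixes a b :: "'n::finite \<Rightarrow> nat"
  assumes "a < b" shows "sum a UNIV < sum b UNIV"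
  using assms by (intro sum_strict_mono_ex1) (auto simp: less_fun_def le_fun_def not_le)

lemma box_downward: "y \<in> box \<rho> \<Longrightarrow> x \<le> y \<Longrightarrow> x \<in> box \<rho>"
  by (auto simp: box_def le_fun_def intro: order_trans)

lemma fun_upd_le_self: "s \<le> p i \<Longrightarrow> p(i := s) \<le> (p :: 'n \<Rightarrow> nat)"
  by (auto simp: le_fun_def)

text \<open>
  Any two comparable points are joined by a monotone path of unit steps.  This is how local
  inequalities on unit squares are summed up to global ones.
\<close>

lemma unit_step_induct [consumes 1, case_names base step]:
  fixes x y :: "'n::finite \<Rightarrow> nat"
  assumes "x \<le> y" and base: "P x"
    and step: "\<And>w i. x \<le> w \<Longrightarrow> w \<le> y \<Longrightarrow> w i < y i \<Longrightarrow> P w \<Longrightarrow> P (w(i := Suc (w i)))"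
  shows "P y"
proof -
  have "x \<le> w \<Longrightarrow> w \<le> y \<Longrightarrow> P w" for w
  proof (induction "sum w UNIV" arbitrary: w rule: less_induct)
    case less
    show ?case
    proof (cases "w = x")
      case False
      then obtain i where i: "x i < w i"
        using less.prems(1) by (metis ext le_funD order_le_imp_less_or_eq)
      let ?v = "w(i := w i - 1)"
      have v: "?v < w" "x \<le> ?v"
        using i less.prems by (auto simp: less_fun_def le_fun_def not_le)
      have "w i \<le> y i" using less.prems by (simp add: le_fun_def)
      then have "?v i < y i" using i by simp
      moreover have "?v \<le> y" using v less.prems by (meson less_imp_le order_trans)
      moreover note v
      ultimately have "P (?v(i := Suc (?v i)))"
        using step less.hyps coordinate_sum_strict_mono by blast
      then show ?thesis using i by simp
    qed (simp add: base)
  qed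
  then show ?thesis using \<open>x \<le> y\<close> by simp
qed

section \<open>Removals and the size function\<close>

text \<open>
  A removal only changes one coordinate, so a statement about it is a statement about the heights
  occurring in \<open>I\<close> on one fibre.
\<close>

lemma is_removal_iff:
  "is_removal I a i b \<longleftrightarrow>
     (\<exists>s<a i. b = a(i := s) \<and> b \<in> I \<and> (\<forall>t. s < t \<and> t < a i \<longrightarrow> a(i := t) \<notin> I))"
proof -
  have lower: "b \<in> lower_in_direction I a i \<longleftrightarrow> (\<exists>s<a i. b = a(i := s) \<and> b \<in> I)" for b
  proof
    assume b: "b \<in> lower_in_direction I a i"
    then have "b = a(i := b i)" by (auto simp: lower_in_direction_def)
    moreover from b have "b i < a i"
      by (metis (mono_tags, lifting) calculation fun_upd_triv le_funD lower_in_direction_def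
          mem_Collect_eq order_le_imp_less_or_eq order_less_imp_le order_less_irrefl)
    ultimately show "\<exists>s<a i. b = a(i := s) \<and> b \<in> I"
      using b by (auto simp: lower_in_direction_def)
  qed (auto simp: lower_in_direction_def less_fun_def le_fun_def not_le)
  show ?thesis
    unfolding is_removal_def Ball_def lower
    by (auto simp: not_le[symmetric]) (metis fun_upd_same not_le)+
qed

lemma removal_below_exists:
  assumes "a(i := s) \<in> I" "s < a i"
  obtains t where "s \<le> t" "t < a i" "is_removal I a i (a(i := t))"
proof -
  let ?S = "{t. t < a i \<and> a(i := t) \<in> I}"
  have fin: "finite ?S" by simp
  have s: "s \<in> ?S" using assms by simp
  then have "Max ?S \<in> ?S" using fin Max_in by blast
  moreover have "t \<le> Max ?S" if "t \<in> ?S" for t using that fin by simp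
  ultimately show thesis
    using s by (intro that[of "Max ?S"]) (auto simp: is_removal_iff not_le[symmetric])
qed

lemma interval_along_fibre:
  assumes "s \<le> u j"
  shows "interval_in I (u(j := s)) u = (\<lambda>k. u(j := k)) ` {k \<in> {s..u j}. u(j := k) \<in> I}"
proof (intro equalityI subsetI)
  fix c assume c: "c \<in> interval_in I (u(j := s)) u"
  have "c = u(j := c j)"
  proof
    fix k show "c k = (u(j := c j)) k"
      using c by (cases "k = j") (auto simp: interval_in_def le_fun_def intro: antisym dest!: spec[of _ k])
  qed
  moreover have "s \<le> c j" "c j \<le> u j" "c \<in> I"
    using c by (auto simp: interval_in_def le_fun_def dest!: spec[of _ j])
  ultimately show "c \<in> (\<lambda>k. u(j := k)) ` {k \<in> {s..u j}. u(j := k) \<in> I}"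
    by (metis (mono_tags, lifting) atLeastAtMost_iff image_eqI mem_Collect_eq)
qed (auto simp: interval_in_def le_fun_def)

lemma card_interval_along_fibre:
  assumes "s \<le> u j"
  shows "card (interval_in I (u(j := s)) u) = card {k \<in> {s..u j}. u(j := k) \<in> I}"
  unfolding interval_along_fibre[where u = u and j = j, OF assms]
  by (intro card_image inj_onI) (metis fun_upd_same)

text \<open>
  Repeated removal in one direction visits every member of the fibre once, from the top down.  So
  the cardinality of an interval along a fibre, as it occurs in the first axiom, is one more than a
  number of removals.
\<close>

lemma removals_along_fibre:
  assumes "u \<in> I" "u(j := s) \<in> I" "s \<le> u j"
  shows "(u, u(j := s)) \<in> removal_rel I ^^ (card (interval_in I (u(j := s)) u) - 1)"
proof -
  have "(u, u(j := s)) \<in> removal_rel I ^^ card {k \<in> {s..<u j}. u(j := k) \<in> I}"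
    using assms
  proof (induction "u j" arbitrary: u rule: less_induct)
    case less
    show ?case
    proof (cases "s = u j")
      case False
      then have "s < u j" using less.prems by simp
      then obtain t where t: "s \<le> t" "t < u j" and rem: "is_removal I u j (u(j := t))"
        using removal_below_exists less.prems(2) by metis
      then have tI: "u(j := t) \<in> I" and gap: "\<And>k. t < k \<Longrightarrow> k < u j \<Longrightarrow> u(j := k) \<notin> I"
        by (auto simp: is_removal_iff dest: fun_cong)
           (metis fun_upd_same)+
      have "{k \<in> {s..<u j}. u(j := k) \<in> I} = insert t {k \<in> {s..<t}. u(j := k) \<in> I}"
        using t tI gap by (auto simp: not_less) (meson linorder_neqE_nat)
      then have "card {k \<in> {s..<u j}. u(j := k) \<in> I} = Suc (card {k \<in> {s..<t}. u(j := k) \<in> I})"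
        by simp
      moreover have "(u, u(j := t)) \<in> removal_rel I"
        using rem less.prems(1) by (auto simp: removal_rel_def)
      moreover have "(u(j := t), u(j := s)) \<in> removal_rel I ^^ card {k \<in> {s..<t}. u(j := k) \<in> I}"
        using less.hyps[of "u(j := t)"] t tI less.prems by simp
      ultimately show ?thesis by (simp only: relpow_Suc_I2)
    qed simp
  qed
  moreover have "{k \<in> {s..u j}. u(j := k) \<in> I} = insert (u j) {k \<in> {s..<u j}. u(j := k) \<in> I}"
    using assms by auto
  ultimately show ?thesis by (simp add: card_interval_along_fibre assms)
qed

lemma removal_less: "is_removal I a i b \<Longrightarrow> b < a"
  by (auto simp: is_removal_def lower_in_direction_def)

lemma removal_mem: "is_removal I a i b \<Longrightarrow> b \<in> I"
  by (auto simp: is_removal_def lower_in_direction_def)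

lemma is_removal_unique: "is_removal I a i b \<Longrightarrow> is_removal I a i c \<Longrightarrow> b = c"
  by (auto simp: is_removal_iff) (metis linorder_neqE_nat)

lemma no_removal_from_zero: "(\<lambda>_. 0, b) \<notin> removal_rel I"
  by (auto simp: removal_rel_def is_removal_iff)

lemma removal_of_nonzero:
  assumes "axiom_I1 I" "a \<in> I" "a \<noteq> (\<lambda>_. 0)"
  obtains i b where "is_removal I a i b"
proof -
  obtain i where "a i \<ge> 1" using assms(3) by (metis ext less_one not_le)
  then show thesis using that assms unfolding axiom_I1_def removals_exist_def by blast
qed

text \<open>
  The first axiom as a diamond property: the descents from the two removals along the fibres reach
  their meet after equally many steps.
\<close>

lemma removals_common_descent:
  assumes I1: "axiom_I1 I" and p: "p \<in> I" and u: "is_removal I p i u" and v: "is_removal I p j v"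
  obtains q n where "q \<in> I" "q < p" "(u, q) \<in> removal_rel I ^^ n" "(v, q) \<in> removal_rel I ^^ n"
proof (cases "i = j")
  case True
  then have "u = v" using u v is_removal_unique by blast
  then show thesis using that[of u 0] removal_less[OF u] removal_mem[OF u] by simp
next
  case False
  from u obtain s where s: "s < p i" "u = p(i := s)" by (auto simp: is_removal_iff)
  from v obtain t where t: "t < p j" "v = p(j := t)" by (auto simp: is_removal_iff)
  let ?q = "inf u v"
  have qu: "?q = u(j := t)" and qv: "?q = v(i := s)"
    using s t False by (auto simp: fun_eq_iff inf_nat_def)
  have q: "?q \<in> I" and card: "card (interval_in I ?q u) = card (interval_in I ?q v)"
    using I1 p u v unfolding axiom_I1_def by blast+
  have le: "t \<le> u j" "s \<le> v i" using s t False by auto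
  have "(u, ?q) \<in> removal_rel I ^^ (card (interval_in I ?q u) - 1)"
    unfolding qu using removal_mem[OF u] q[unfolded qu] le(1) by (rule removals_along_fibre)
  moreover have "(v, ?q) \<in> removal_rel I ^^ (card (interval_in I ?q v) - 1)"
    unfolding qv using removal_mem[OF v] q[unfolded qv] le(2) by (rule removals_along_fibre)
  moreover have "?q < p"
    using removal_less[OF u] by (meson inf_le1 le_less_trans)
  ultimately show thesis using that q card by metis
qed

text \<open>
  As for Jordan-Hoelder chains: two descents that begin with different removals are compared, by
  induction, with descents through a common lower point that is equally far from both.
\<close>

lemma removal_length_unique:
  assumes I1: "axiom_I1 I" and "a \<in> I"
  shows "\<exists>!n. (a, \<lambda>_. 0) \<in> removal_rel I ^^ n"
  using \<open>a \<in> I\<close>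
proof (induction "sum a UNIV" arbitrary: a rule: less_induct)
  case less
  show ?case
  proof (cases "a = (\<lambda>_. 0)")
    case True
    have "n = 0" if "(a, \<lambda>_. 0) \<in> removal_rel I ^^ n" for n
      using that no_removal_from_zero True by (metis not0_implies_Suc relpow_Suc_E2)
    then show ?thesis using True by (intro ex1I[of _ 0]) auto
  next
    case False
    have IH: "\<exists>!n. (b, \<lambda>_. 0) \<in> removal_rel I ^^ n" if "b \<in> I" "b < a" for b
      using less.hyps that coordinate_sum_strict_mono by blast
    have first_step: "\<exists>i b n'. n = Suc n' \<and> is_removal I a i b \<and> (b, \<lambda>_. 0) \<in> removal_rel I ^^ n'"
      if n: "(a, \<lambda>_. 0) \<in> removal_rel I ^^ n" for n
    proof -
      obtain n' where "n = Suc n'" using n False by (cases n) auto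
      moreover then obtain b where "(a, b) \<in> removal_rel I" "(b, \<lambda>_. 0) \<in> removal_rel I ^^ n'"
        using n by (meson relpow_Suc_D2)
      ultimately show ?thesis by (auto simp: removal_rel_def)
    qed
    have unique: "n = m"
      if n: "(a, \<lambda>_. 0) \<in> removal_rel I ^^ n" and m: "(a, \<lambda>_. 0) \<in> removal_rel I ^^ m" for n m
    proof -
      obtain i u n' where u: "n = Suc n'" "is_removal I a i u" "(u, \<lambda>_. 0) \<in> removal_rel I ^^ n'"
        using first_step[OF n] by blast
      obtain j v m' where v: "m = Suc m'" "is_removal I a j v" "(v, \<lambda>_. 0) \<in> removal_rel I ^^ m'"
        using first_step[OF m] by blast
      obtain q k where q: "q \<in> I" "q < a" "(u, q) \<in> removal_rel I ^^ k" "(v, q) \<in> removal_rel I ^^ k"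
        using removals_common_descent[OF I1 less.prems u(2) v(2)] .
      \<comment> \<open>Both tails are as long as the detour through \<open>q\<close>.\<close>
      obtain l where "(q, \<lambda>_. 0) \<in> removal_rel I ^^ l" using IH q by blast
      then have "(u, \<lambda>_. 0) \<in> removal_rel I ^^ (k + l)" "(v, \<lambda>_. 0) \<in> removal_rel I ^^ (k + l)"
        using q by (auto simp: relpow_add)
      then have "n' = k + l" "m' = k + l"
        using IH u v removal_less removal_mem by blast+
      then show ?thesis using u v by simp
    qed
    obtain i b where b: "is_removal I a i b" using removal_of_nonzero[OF I1 less.prems False] .
    then obtain n where "(b, \<lambda>_. 0) \<in> removal_rel I ^^ n"
      using IH removal_less removal_mem by blast
    moreover have "(a, b) \<in> removal_rel I" using b less.prems by (auto simp: removal_rel_def)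
    ultimately have "(a, \<lambda>_. 0) \<in> removal_rel I ^^ Suc n" by (meson relpow_Suc_I2)
    then show ?thesis using unique by blast
  qed
qed

lemma size_inI:
  assumes "axiom_I1 I" "a \<in> I" "(a, \<lambda>_. 0) \<in> removal_rel I ^^ n"
  shows "size_in I a = n"
  unfolding size_in_def using removal_length_unique[OF assms(1,2)] assms(3) by (rule the1_equality)

lemma size_in_zero: "axiom_I1 I \<Longrightarrow> (\<lambda>_. 0) \<in> I \<Longrightarrow> size_in I (\<lambda>_. 0) = 0"
  by (rule size_inI) auto

lemma size_in_removal:
  assumes I1: "axiom_I1 I" and a: "a \<in> I" and b: "is_removal I a i b"
  shows "size_in I a = Suc (size_in I b)"
proof -
  obtain n where n: "(b, \<lambda>_. 0) \<in> removal_rel I ^^ n"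
    using removal_length_unique[OF I1 removal_mem[OF b]] by blast
  moreover have "(a, b) \<in> removal_rel I" using a b by (auto simp: removal_rel_def)
  ultimately have "(a, \<lambda>_. 0) \<in> removal_rel I ^^ Suc n" by (meson relpow_Suc_I2)
  then show ?thesis using size_inI[OF I1 a] size_inI[OF I1 removal_mem[OF b] n] by simp
qed

text \<open>
  The size is determined by its value at \<open>0\<close> and its behaviour under removals.  Applied to the rank
  of a matricube, this identifies the size of an independent.
\<close>

lemma size_in_eqI:
  assumes I1: "axiom_I1 I" and zero: "f (\<lambda>_. 0) = (0::int)"
    and step: "\<And>a i b. a \<in> I \<Longrightarrow> is_removal I a i b \<Longrightarrow> f a = f b + 1"
    and "a \<in> I"
  shows "int (size_in I a) = f a"
  using \<open>a \<in> I\<close>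
proof (induction "sum a UNIV" arbitrary: a rule: less_induct)
  case less
  show ?case
  proof (cases "a = (\<lambda>_. 0)")
    case True
    then show ?thesis using size_in_zero[OF I1] less.prems zero by simp
  next
    case False
    then obtain i b where b: "is_removal I a i b" using removal_of_nonzero[OF I1 less.prems] by blast
    then have "int (size_in I b) = f b"
      using less.hyps removal_mem coordinate_sum_strict_mono[OF removal_less] by blast
    then show ?thesis using step[OF less.prems b] size_in_removal[OF I1 less.prems b] by simp
  qed
qed

section \<open>From a matricube to its independents\<close>

lemma matricube_mono: "matricube \<rho> r \<Longrightarrow> y \<in> box \<rho> \<Longrightarrow> x \<le> y \<Longrightarrow> r x \<le> r y"
  unfolding matricube_def using box_downward by blast

text \<open>
  Submodularity for the two points \<open>x\<close> and \<open>y(i := s)\<close>, whose join is \<open>y\<close> and whose meet is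
  \<open>x(i := s)\<close>.
\<close>

lemma matricube_diminishing:
  assumes r: "matricube \<rho> r" and y: "y \<in> box \<rho>" and le: "x \<le> y" "x i = y i" "s \<le> x i"
  shows "r y - r (y(i := s)) \<le> r x - r (x(i := s))"
proof -
  have "sup x (y(i := s)) = y" "inf x (y(i := s)) = x(i := s)"
    using le by (auto simp: fun_eq_iff le_fun_def sup_nat_def inf_nat_def max_def min_def
        intro: antisym)
  moreover have "x \<in> box \<rho>" "y(i := s) \<in> box \<rho>"
    using y le by (auto intro: box_downward fun_upd_le_self)
  ultimately show ?thesis using r unfolding matricube_def by (metis add.commute diff_le_eq le_diff_eq diff_add_eq)
qed

text \<open>
  The bound assumed on the axes carries over to all points, since the gain of a step is largest on
  the axis.
\<close>

lemma matricube_unit_step: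
  assumes r: "matricube \<rho> r" and y: "y \<in> box \<rho>" and "y i \<ge> 1"
  shows "r y \<le> r (y(i := y i - 1)) + 1"
proof -
  have "r y - r (y(i := y i - 1)) \<le> r (axis_point (y i) i) - r ((axis_point (y i) i)(i := y i - 1))"
    using r y by (intro matricube_diminishing) (auto simp: axis_point_def le_fun_def)
  moreover have "(axis_point (y i) i)(i := y i - 1) = axis_point (y i - 1) i"
    by (auto simp: axis_point_def)
  moreover have "r (axis_point (y i) i) - r (axis_point (y i - 1) i) \<le> 1"
    using r y \<open>y i \<ge> 1\<close> by (auto simp: matricube_def box_def)
  ultimately show ?thesis by simp
qed

text \<open>
  In the directions other than \<open>i\<close>, the point \<open>p(i := s)\<close> inherits the independence condition from
  \<open>p\<close>.  Only the condition in direction \<open>i\<close> remains, and it is vacuous at height \<open>0\<close>; so every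
  fibre below \<open>p\<close> has an independent at its bottom, which is what makes removals exist.
\<close>

lemma independents_fibre_iff:
  assumes r: "matricube \<rho> r" and p: "p \<in> independents \<rho> r" and "s \<le> p i"
  shows "p(i := s) \<in> independents \<rho> r \<longleftrightarrow> s = 0 \<or> r (p(i := s - 1)) = r (p(i := s)) - 1"
proof
  let ?q = "p(i := s)"
  have pbox: "p \<in> box \<rho>" and qp: "?q \<le> p"
    using p \<open>s \<le> p i\<close> by (auto simp: independents_def intro: fun_upd_le_self)
  then have qbox: "?q \<in> box \<rho>" using box_downward by blast
  assume eq: "s = 0 \<or> r (p(i := s - 1)) = r ?q - 1"
  have "r (?q(k := ?q k - 1)) = r ?q - 1" if k: "?q k \<ge> 1" for k
  proof (cases "k = i")
    case True then show ?thesis using eq k by simp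
  next
    case False
    \<comment> \<open>The step at \<open>p\<close> in direction \<open>k\<close> gains one, so by diminishing returns the
      one at the lower point does too.\<close>
    then have "r p - r (p(k := p k - 1)) \<le> r ?q - r (?q(k := p k - 1))"
      using qp by (intro matricube_diminishing[OF r pbox]) auto
    moreover have "r (p(k := p k - 1)) = r p - 1"
      using p k False by (simp add: independents_def)
    moreover have "r ?q \<le> r (?q(k := ?q k - 1)) + 1"
      using matricube_unit_step[OF r qbox k] .
    ultimately show ?thesis using False by simp
  qed
  then show "?q \<in> independents \<rho> r" using qbox by (simp add: independents_def)
qed (auto simp: independents_def dest!: spec[of _ i])

lemma independents_fibre_zero:
  assumes "matricube \<rho> r" "p \<in> independents \<rho> r"
  shows "p(i := 0) \<in> independents \<rho> r"
  using independents_fibre_iff[OF assms, of 0 i] by simp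

text \<open>
  Along a fibre the rank rises by one at each independent and stays constant at every other point.
\<close>

lemma rank_difference_along_fibre:
  assumes r: "matricube \<rho> r" and p: "p \<in> independents \<rho> r" and "s \<le> t" "t \<le> p i"
  shows "int (card {k \<in> {s<..t}. p(i := k) \<in> independents \<rho> r}) = r (p(i := t)) - r (p(i := s))"
  using \<open>s \<le> t\<close> \<open>t \<le> p i\<close>
proof (induction t rule: dec_induct)
  case (step t)
  have pbox: "p \<in> box \<rho>" using p by (simp add: independents_def)
  have q: "p(i := Suc t) \<in> box \<rho>"
    using step.prems pbox by (meson box_downward fun_upd_le_self)
  have up: "r (p(i := t)) \<le> r (p(i := Suc t))"
    by (rule matricube_mono[OF r q]) (simp add: le_fun_def)
  have one: "r (p(i := Suc t)) \<le> r (p(i := t)) + 1"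
    using matricube_unit_step[OF r q, of i] by simp
  have iff: "p(i := Suc t) \<in> independents \<rho> r \<longleftrightarrow> r (p(i := t)) = r (p(i := Suc t)) - 1"
    using independents_fibre_iff[OF r p step.prems] by simp
  let ?S = "\<lambda>t. {k \<in> {s<..t}. p(i := k) \<in> independents \<rho> r}"
  show ?case
  proof (cases "p(i := Suc t) \<in> independents \<rho> r")
    case True
    then have "?S (Suc t) = insert (Suc t) (?S t)" using step.hyps by (auto simp: le_Suc_eq)
    then have "int (card (?S (Suc t))) = int (card (?S t)) + 1" by simp
    moreover have "r (p(i := t)) = r (p(i := Suc t)) - 1" using True iff by blast
    ultimately show ?thesis using step.IH step.prems by linarith
  next
    case False
    then have "?S (Suc t) = ?S t" by (auto simp: le_Suc_eq)
    then have "card (?S (Suc t)) = card (?S t)" by (rule arg_cong)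
    moreover have "r (p(i := t)) \<noteq> r (p(i := Suc t)) - 1" using False iff by blast
    ultimately show ?thesis using step.IH step.prems up one by linarith
  qed
qed simp

text \<open>
  Above a removal, \<open>p\<close> itself is the only independent on the fibre, so exactly one unit of rank is
  lost.
\<close>

lemma rank_removal:
  assumes r: "matricube \<rho> r" and p: "p \<in> independents \<rho> r"
    and u: "is_removal (independents \<rho> r) p i u"
  shows "r p = r u + 1"
proof -
  from u obtain s where s: "s < p i" "u = p(i := s)"
    and gap: "\<And>t. s < t \<Longrightarrow> t < p i \<Longrightarrow> p(i := t) \<notin> independents \<rho> r"
    by (auto simp: is_removal_iff)
  have "{k \<in> {s<..p i}. p(i := k) \<in> independents \<rho> r} = {p i}"
    using s p gap by (auto simp: le_less)
  then show ?thesis using rank_difference_along_fibre[OF r p, of s "p i" i] s by simp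
qed

lemma card_interval_rank:
  assumes r: "matricube \<rho> r" and u: "u \<in> independents \<rho> r"
    and q: "u(j := s) \<in> independents \<rho> r" "s \<le> u j"
  shows "int (card (interval_in (independents \<rho> r) (u(j := s)) u)) = r u - r (u(j := s)) + 1"
proof -
  have "{k \<in> {s..u j}. u(j := k) \<in> independents \<rho> r} =
      insert s {k \<in> {s<..u j}. u(j := k) \<in> independents \<rho> r}"
    using q by auto
  then show ?thesis
    using rank_difference_along_fibre[OF r u q(2) order_refl] q by (simp add: card_interval_along_fibre)
qed

text \<open>
  The meet of two removals of \<open>p\<close> meets the independence condition in each direction because a
  point above it does: \<open>u\<close>, \<open>v\<close> or \<open>p\<close>.  The two intervals then have
  \<open>r u - r (inf u v) + 1\<close> and \<open>r v - r (inf u v) + 1\<close> elements, and \<open>r u = r v = r p - 1\<close>.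
\<close>

lemma independents_I1:
  assumes r: "matricube \<rho> r"
  shows "axiom_I1 (independents \<rho> r)"
  unfolding axiom_I1_def
proof (intro conjI ballI allI impI)
  let ?I = "independents \<rho> r"
  show "removals_exist ?I"
    unfolding removals_exist_def
    by (meson independents_fibre_zero[OF r] removal_below_exists less_le_trans zero_less_one)
  fix p i j u v
  assume p: "p \<in> ?I" and uv: "is_removal ?I p i u \<and> is_removal ?I p j v"
  then have u: "is_removal ?I p i u" and v: "is_removal ?I p j v" by auto
  obtain s where s: "s < p i" "u = p(i := s)" using u by (auto simp: is_removal_iff)
  obtain t where t: "t < p j" "v = p(j := t)" using v by (auto simp: is_removal_iff)
  have uI: "u \<in> ?I" and vI: "v \<in> ?I" using u v removal_mem by auto
  have "inf u v \<in> ?I \<and> card (interval_in ?I (inf u v) u) = card (interval_in ?I (inf u v) v)"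
  proof (cases "i = j")
    case True
    then have "u = v" using u v is_removal_unique by blast
    then show ?thesis using uI by simp
  next
    case False
    have qu: "inf u v = u(j := t)" and qv: "inf u v = v(i := s)"
      using s t False by (auto simp: fun_eq_iff inf_nat_def)
    have qI: "u(j := t) \<in> ?I"
    proof (cases t)
      case 0
      then show ?thesis using independents_fibre_zero[OF r uI] by simp
    next
      case (Suc t')
      \<comment> \<open>The unit step at \<open>v\<close> in direction \<open>j\<close> gains one, so the one at the meet below \<open>v\<close> does too.\<close>
      have vbox: "v \<in> box \<rho>" using vI by (simp add: independents_def)
      have "r v - r (v(j := t')) \<le> r (u(j := t)) - r ((u(j := t))(j := t'))"
        using s t Suc False by (intro matricube_diminishing[OF r vbox]) (auto simp: le_fun_def)
      moreover have "r (v(j := t')) = r v - 1"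
        using vI t Suc by (auto simp: independents_def dest!: spec[of _ j])
      moreover have "r (u(j := t)) \<le> r (u(j := t')) + 1"
        using matricube_unit_step[OF r, of "u(j := t)" j] s t Suc False uI
          box_downward[OF _ fun_upd_le_self[of t u j]]
        by (auto simp: independents_def)
      ultimately have "r (u(j := t')) = r (u(j := Suc t')) - 1" using Suc by simp
      then show ?thesis using independents_fibre_iff[OF r uI] s t Suc False by auto
    qed
    then have "int (card (interval_in ?I (inf u v) u)) = r u - r (inf u v) + 1"
      "int (card (interval_in ?I (inf u v) v)) = r v - r (inf u v) + 1"
      using card_interval_rank[OF r uI, of j t] card_interval_rank[OF r vI, of i s] s t False
      unfolding qu[symmetric] qv[symmetric] by auto
    moreover have "r u = r v" using rank_removal[OF r p u] rank_removal[OF r p v] by simp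
    ultimately show ?thesis using qI qu by simp
  qed
  then show "inf u v \<in> ?I" "card (interval_in ?I (inf u v) u) = card (interval_in ?I (inf u v) v)"
    by auto
qed

lemma size_independent:
  assumes r: "matricube \<rho> r" and "p \<in> independents \<rho> r"
  shows "int (size_in (independents \<rho> r) p) = r p"
  using independents_I1[OF r] _ rank_removal[OF r] assms(2)
  by (rule size_in_eqI) (use r in \<open>auto simp: matricube_def\<close>)

text \<open>
  A minimal point among those below \<open>x\<close> with the rank of \<open>x\<close> loses rank under every unit step down,
  that is, it is independent.
\<close>

lemma independent_of_full_rank:
  assumes r: "matricube \<rho> r" and x: "x \<in> box \<rho>"
  obtains c where "c \<in> independents \<rho> r" "c \<le> x" "r c = r x"
proof -
  let ?S = "{c. c \<le> x \<and> r c = r x}"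
  have "finite ?S" by (rule finite_subset[OF _ finite_points_below[of x]]) auto
  moreover have "x \<in> ?S" by simp
  ultimately obtain c where c: "c \<in> ?S" and min: "\<forall>d\<in>?S. d \<le> c \<longrightarrow> c = d"
    using finite_has_minimal2[of ?S x] by blast
  have cbox: "c \<in> box \<rho>" using c x box_downward by blast
  have "r (c(i := c i - 1)) = r c - 1" if i: "c i \<ge> 1" for i
  proof -
    have lt: "c(i := c i - 1) \<le> c" "c(i := c i - 1) \<noteq> c"
      using i by (auto simp: le_fun_def fun_eq_iff)
    moreover have "c(i := c i - 1) \<le> x" using lt(1) c by (auto intro: order_trans)
    ultimately have "r (c(i := c i - 1)) \<noteq> r c" using min c by auto
    then show ?thesis
      using matricube_mono[OF r cbox lt(1)] matricube_unit_step[OF r cbox i] by simp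
  qed
  then show thesis using that c cbox by (auto simp: independents_def)
qed

text \<open>
  The exchange part asks for a point of rank above \<open>r a\<close> below \<open>sup a b\<close> that stays strictly below
  \<open>b\<close> in a coordinate of \<open>less_coords a b\<close>.  If \<open>sup a b\<close>, lowered to \<open>a\<close> in coordinate \<open>i\<close> or in
  coordinate \<open>j\<close>, had rank at most \<open>r a\<close> both times, submodularity would force
  \<open>r (sup a b) \<le> r a < r b\<close>.
\<close>

lemma independents_I2:
  assumes r: "matricube \<rho> r"
  shows "axiom_I2 (independents \<rho> r)"
  unfolding axiom_I2_def
proof (intro conjI ballI impI)
  let ?I = "independents \<rho> r"
  fix a b assume a: "a \<in> ?I" and b: "b \<in> ?I"
  note size = size_independent[OF r]
  have box: "a \<in> box \<rho>" "b \<in> box \<rho>" using a b by (auto simp: independents_def)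
  {
    assume "a < b"
    then obtain i where i: "a i < b i" by (auto simp: less_fun_def le_fun_def not_le)
    then have "a \<le> b(i := b i - 1)" using \<open>a < b\<close> by (auto simp: less_fun_def le_fun_def)
    moreover have "b(i := b i - 1) \<in> box \<rho>" using box by (meson box_downward fun_upd_le_self diff_le_self)
    ultimately have "r a \<le> r (b(i := b i - 1))" using matricube_mono[OF r] by blast
    also have "\<dots> = r b - 1" using b i by (auto simp: independents_def)
    finally show "size_in ?I a < size_in ?I b" using size a b by (metis less_iff_diff_less_0 of_nat_less_iff zle_diff1_eq)
  next
    assume ab: "size_in ?I a < size_in ?I b \<and> card (less_coords a b) \<ge> 2"
    then obtain i j where ij: "i \<in> less_coords a b" "j \<in> less_coords a b" "i \<noteq> j"
      by (metis card_2_iff insert_subset obtain_subset_with_card_n)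
    let ?z = "sup a b"
    let ?x = "?z(i := a i)" and ?y = "?z(j := a j)"
    have z: "?z \<in> box \<rho>" using box by (auto simp: box_def)
    have xy: "?x \<le> ?z" "?y \<le> ?z" "sup ?x ?y = ?z" "a \<le> inf ?x ?y"
      using ij by (auto simp: le_fun_def fun_eq_iff less_coords_def sup_nat_def inf_nat_def)
    then have xybox: "?x \<in> box \<rho>" "?y \<in> box \<rho>" using z box_downward by blast+
    have "r ?x + r ?y \<ge> r ?z + r (inf ?x ?y)"
      using r xybox xy(3) unfolding matricube_def by metis
    moreover have "r a \<le> r (inf ?x ?y)"
      by (rule matricube_mono[OF r _ xy(4)]) (use xybox box_downward inf_le1 in blast)
    moreover have "r b \<le> r ?z" by (rule matricube_mono[OF r z]) simp
    moreover have "r a < r b" using ab size a b by (metis of_nat_less_iff)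
    ultimately have "r ?x > r a \<or> r ?y > r a" by linarith
    then obtain w k where w: "w \<le> ?z" "r w > r a" "k \<in> less_coords a b" "w k < b k"
    proof
      assume "r ?x > r a" then show thesis using that[of ?x i] xy ij by (auto simp: less_coords_def)
    next
      assume "r ?y > r a" then show thesis using that[of ?y j] xy ij by (auto simp: less_coords_def)
    qed
    obtain c where c: "c \<in> ?I" "c \<le> w" "r c = r w"
      using independent_of_full_rank[OF r box_downward[OF z w(1)]] .
    have "size_in ?I c > size_in ?I a" using size c a w by (metis of_nat_less_iff)
    moreover have "c k < b k" using c w by (auto simp: le_fun_def intro: le_less_trans)
    ultimately show "\<exists>c\<in>?I. c \<le> ?z \<and> size_in ?I c > size_in ?I a \<and> (\<exists>i\<in>less_coords a b. c i < b i)"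
      using c w order_trans by blast
  }
qed

section \<open>From a set of points to a matricube\<close>

text \<open>
  The maximum is meaningful when \<open>I\<close> contains \<open>0\<close>, since the set below \<open>x\<close> is then nonempty.
\<close>

definition rank_of :: "('n::finite \<Rightarrow> nat) set \<Rightarrow> ('n \<Rightarrow> nat) \<Rightarrow> int" where
  "rank_of I x = int (Max (size_in I ` {a \<in> I. a \<le> x}))"

lemma zero_mem_of_I1:
  assumes I1: "axiom_I1 I" and "a \<in> I" shows "(\<lambda>_. 0) \<in> I"
  using \<open>a \<in> I\<close>
proof (induction "sum a UNIV" arbitrary: a rule: less_induct)
  case less
  show ?case
  proof (cases "a = (\<lambda>_. 0)")
    case False
    then obtain i b where b: "is_removal I a i b" using removal_of_nonzero[OF I1 less.prems] by blast
    show ?thesis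
      by (rule less.hyps[OF coordinate_sum_strict_mono[OF removal_less[OF b]] removal_mem[OF b]])
  qed (use less.prems in simp)
qed

lemma size_le_rank_of: "a \<in> I \<Longrightarrow> a \<le> x \<Longrightarrow> int (size_in I a) \<le> rank_of I x"
  unfolding rank_of_def
  by (intro of_nat_mono Max_ge finite_imageI finite_subset[OF _ finite_points_below[of x]]) auto

lemma rank_of_attained:
  assumes "(\<lambda>_. 0) \<in> I"
  obtains a where "a \<in> I" "a \<le> x" "int (size_in I a) = rank_of I x"
proof -
  have "finite {a \<in> I. a \<le> x}"
    by (rule finite_subset[OF _ finite_points_below[of x]]) auto
  moreover have "(\<lambda>_. 0) \<in> {a \<in> I. a \<le> x}" using assms by (simp add: le_fun_def)
  ultimately have "Max (size_in I ` {a \<in> I. a \<le> x}) \<in> size_in I ` {a \<in> I. a \<le> x}"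
    by (intro Max_in) auto
  then show thesis using that by (auto simp: rank_of_def)
qed

lemma rank_of_mono:
  assumes "(\<lambda>_. 0) \<in> I" "x \<le> y" shows "rank_of I x \<le> rank_of I y"
  using assms by (metis order_trans rank_of_attained size_le_rank_of)

text \<open>
  A member of largest size below the upper point is either below \<open>x\<close> or loses just one unit of size when
  it is moved below \<open>x\<close> by the removal in direction \<open>i\<close>.
\<close>

lemma rank_of_unit_step:
  assumes I1: "axiom_I1 I" and zero: "(\<lambda>_. 0) \<in> I"
  shows "rank_of I (x(i := Suc (x i))) \<le> rank_of I x + 1"
proof -
  obtain a where a: "a \<in> I" "a \<le> x(i := Suc (x i))" "int (size_in I a) = rank_of I (x(i := Suc (x i)))"
    using rank_of_attained[OF zero] .
  show ?thesis
  proof (cases "a \<le> x")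
    case True
    then show ?thesis using a size_le_rank_of[of a I x] by simp
  next
    case False
    then have "a i = Suc (x i)"
      using a(2) by (auto simp: le_fun_def) (metis le_SucE)
    then obtain b where b: "is_removal I a i b"
      using I1 a by (fastforce simp: axiom_I1_def removals_exist_def)
    then have "b \<le> x"
      using a(2) \<open>a i = Suc (x i)\<close>
      by (auto simp: is_removal_iff le_fun_def) (metis (full_types))
    then show ?thesis
      using size_le_rank_of[OF removal_mem[OF b]] size_in_removal[OF I1 a(1) b] a(3) by fastforce
  qed
qed

text \<open>
  Members of \<open>I\<close> are compared by size.  Suppose the inequality fails on a unit square with bottom \<open>x\<close>.  As a unit step gains at most one,
  the other two corners have the rank of \<open>x\<close> and the top has a larger one.  Let \<open>a\<close> be a largest
  member below \<open>x\<close>.  The members below the top that are larger than \<open>a\<close> all reach the top in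
  both coordinates \<open>i\<close> and \<open>j\<close>, since they would otherwise lie below an intermediate corner.  So
  each of them can be exchanged with \<open>a\<close>.  Choosing one, \<open>b\<close>, for which the coordinate sum of
  \<open>sup a b\<close> is least rules this out: the point \<open>c\<close> of the exchange is again such a member, but
  \<open>sup a c\<close> is strictly below \<open>sup a b\<close>.
\<close>

lemma rank_of_local_submodular:
  assumes I1: "axiom_I1 I" and I2: "axiom_I2 I" and zero: "(\<lambda>_. 0) \<in> I" and "i \<noteq> j"
  defines "r \<equiv> rank_of I"
  shows "r (x(i := Suc (x i), j := Suc (x j))) + r x \<le> r (x(i := Suc (x i))) + r (x(j := Suc (x j)))"
proof (rule ccontr)
  let ?xi = "x(i := Suc (x i))" and ?xj = "x(j := Suc (x j))"
  let ?z = "x(i := Suc (x i), j := Suc (x j))"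
  assume "\<not> ?thesis"
  moreover have "r ?z \<le> r ?xi + 1" "r ?z \<le> r ?xj + 1"
    using rank_of_unit_step[OF I1 zero, of ?xi j] rank_of_unit_step[OF I1 zero, of ?xj i] \<open>i \<noteq> j\<close>
    by (simp_all add: r_def fun_upd_twist)
  moreover have "r x \<le> r ?xi" "r x \<le> r ?xj"
    unfolding r_def by (auto intro!: rank_of_mono zero simp: le_fun_def)
  ultimately have flat: "r ?xi = r x" "r ?xj = r x" and up: "r ?z > r x" by linarith+
  obtain a where a: "a \<in> I" "a \<le> x" "int (size_in I a) = r x"
    using rank_of_attained[OF zero] unfolding r_def .
  define B where "B = {b \<in> I. b \<le> ?z \<and> size_in I a < size_in I b}"
  obtain b0 where "b0 \<in> I" "b0 \<le> ?z" "int (size_in I b0) = r ?z"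
    using rank_of_attained[OF zero] unfolding r_def .
  then have "b0 \<in> B" using up a by (simp add: B_def)
  then obtain b where b: "b \<in> B" and least: "\<And>c. c \<in> B \<Longrightarrow> sum (sup a b) UNIV \<le> sum (sup a c) UNIV"
    using ex_has_least_nat[of "\<lambda>b. b \<in> B" b0 "\<lambda>b. sum (sup a b) UNIV"] by blast
  have full: "c i = Suc (x i)" "c j = Suc (x j)" if "c \<in> B" for c
  proof -
    have c: "c \<in> I" "c \<le> ?z" "size_in I a < size_in I c" using that by (auto simp: B_def)
    have "\<not> c \<le> ?xi" "\<not> c \<le> ?xj"
      using size_le_rank_of[OF c(1)] c(3) a(3) flat unfolding r_def by fastforce+
    then obtain k l where "c k > ?xi k" "c l > ?xj l" by (auto simp: le_fun_def not_le)
    moreover have "c k \<le> ?z k" "c l \<le> ?z l" using c(2) by (auto simp: le_fun_def)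
    ultimately show "c i = Suc (x i)" "c j = Suc (x j)"
      using \<open>i \<noteq> j\<close> by (auto split: if_splits)
  qed
  have "{i, j} \<subseteq> less_coords a b"
    using full[OF b] a(2) by (auto simp: less_coords_def le_fun_def le_imp_less_Suc)
  then have "card (less_coords a b) \<ge> 2"
    using \<open>i \<noteq> j\<close> card_mono[of "less_coords a b" "{i, j}"] by simp
  then obtain c k where c: "c \<in> I" "c \<le> sup a b" "size_in I c > size_in I a"
    and k: "a k < b k" "c k < b k"
    using I2 a b unfolding axiom_I2_def B_def less_coords_def by blast
  have "a \<le> ?z" using a(2) by (auto simp: le_fun_def le_SucI)
  then have "sup a b \<le> ?z" using b by (simp add: B_def)
  then have "c \<le> ?z" using c(2) by (rule order_trans[rotated])
  then have "c \<in> B" using c by (auto simp: B_def)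
  moreover have "sup a c < sup a b"
  proof -
    have "sup a c \<le> sup a b" using c(2) by simp
    moreover have "sup a c k < sup a b k" using k by (simp add: sup_nat_def)
    then have "\<not> sup a b \<le> sup a c" by (meson le_funD not_le)
    ultimately show ?thesis by (simp add: less_le_not_le)
  qed
  ultimately show False using least coordinate_sum_strict_mono by fastforce
qed

text \<open>
  Summing the local inequality along a path from \<open>u\<close> to \<open>v\<close> gives diminishing returns of a unit
  step; summing these along a path from \<open>inf x y\<close> to \<open>x\<close>, joined with \<open>y\<close> at each point, gives
  submodularity.
\<close>

lemma submodular_of_local:
  fixes f :: "('n::finite \<Rightarrow> nat) \<Rightarrow> int"
  assumes local_sub: "\<And>x i j. i \<noteq> j \<Longrightarrow>
      f (x(i := Suc (x i), j := Suc (x j))) + f x \<le> f (x(i := Suc (x i))) + f (x(j := Suc (x j)))"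
  shows "f (sup x y) + f (inf x y) \<le> f x + f y"
proof -
  have dim: "f (v(i := Suc (v i))) - f v \<le> f (u(i := Suc (u i))) - f u" if "u \<le> v" "u i = v i" for u v i
    using \<open>u \<le> v\<close>
  proof (induction rule: unit_step_induct[where
        P = "\<lambda>w. f (w(i := Suc (w i))) - f w \<le> f (u(i := Suc (u i))) - f u"])
    case (step w k)
    have "u i \<le> w i" "w i \<le> v i" using step by (auto simp: le_fun_def)
    then have "w i = v i" using \<open>u i = v i\<close> by simp
    then have "k \<noteq> i" using step by auto
    then have "(w(k := Suc (w k)))(i := Suc ((w(k := Suc (w k))) i)) = w(i := Suc (w i), k := Suc (w k))"
      by (auto simp: fun_eq_iff)
    then show ?case
      using local_sub[of i k w] step.IH \<open>k \<noteq> i\<close> by simp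
  qed simp
  have "inf x y \<le> x" by simp
  then have "f (sup x y) - f y \<le> f x - f (inf x y)"
  proof (induction rule: unit_step_induct[where
        P = "\<lambda>w. f (sup w y) - f y \<le> f w - f (inf x y)"])
    case base
    have "sup (inf x y) y = y" by (simp add: sup_absorb2)
    then show ?case by simp
  next
    case (step w k)
    have "inf x y k \<le> w k" using step by (auto simp: le_fun_def)
    \<comment> \<open>Past \<open>inf x y\<close>, the path moves only in coordinates where it is at least as high as \<open>y\<close>, so
      joining with \<open>y\<close> commutes with the step.\<close>
    then have yk: "y k \<le> w k" using step by (auto simp: inf_nat_def min_def split: if_splits)
    have "sup (w(k := Suc (w k))) y = (sup w y)(k := Suc (sup w y k))"
      using yk by (auto simp: fun_eq_iff sup_nat_def max_def)
    moreover have "f ((sup w y)(k := Suc (sup w y k))) - f (sup w y) \<le> f (w(k := Suc (w k))) - f w"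
      using yk by (intro dim) (auto simp: sup_nat_def max_def)
    ultimately show ?case using step by simp
  qed
  then show ?thesis by simp
qed

lemma matricube_rank_of:
  assumes I1: "axiom_I1 I" and I2: "axiom_I2 I" and zero: "(\<lambda>_. 0) \<in> I"
  shows "matricube \<rho> (rank_of I)"
  unfolding matricube_def
proof (intro conjI allI impI ballI)
  have "{a \<in> I. a \<le> (\<lambda>_. 0)} = {\<lambda>_. 0}" using zero by (auto simp: le_fun_def)
  then show "rank_of I (\<lambda>_. 0) = 0"
    using size_in_zero[OF I1 zero] by (simp add: rank_of_def)
next
  fix i t assume "1 \<le> t \<and> t \<le> \<rho> i"
  then have "axis_point t i = (axis_point (t - 1) i)(i := Suc (axis_point (t - 1) i i))"
    by (auto simp: axis_point_def)
  then show "rank_of I (axis_point t i) - rank_of I (axis_point (t - 1) i) \<le> 1"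
    using rank_of_unit_step[OF I1 zero, of "axis_point (t - 1) i" i] by simp
next
  fix x y
  show "rank_of I x + rank_of I y \<ge> rank_of I (sup x y) + rank_of I (inf x y)"
    using submodular_of_local rank_of_local_submodular[OF I1 I2 zero] by blast
qed (use rank_of_mono[OF zero] in blast)

lemma rank_of_mem:
  assumes I2: "axiom_I2 I" and zero: "(\<lambda>_. 0) \<in> I" and a: "a \<in> I"
  shows "rank_of I a = int (size_in I a)"
proof (rule antisym)
  obtain b where b: "b \<in> I" "b \<le> a" "int (size_in I b) = rank_of I a"
    using rank_of_attained[OF zero] .
  then show "rank_of I a \<le> int (size_in I a)"
    using I2 a unfolding axiom_I2_def by (metis le_less nat_int_comparison(2) order_le_less)
qed (simp add: a size_le_rank_of)

text \<open>
  A member of \<open>I\<close> of largest size below an independent \<open>p\<close> must be \<open>p\<close>, or else it would still be below some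
  \<open>p - e\<^sub>i\<close>, whose rank is smaller.  Conversely, a member \<open>p\<close> of \<open>I\<close> is strictly larger in size than
  every member below \<open>p - e\<^sub>i\<close>, so each unit step down from \<open>p\<close> loses rank.
\<close>

lemma independents_rank_of:
  assumes I1: "axiom_I1 I" and I2: "axiom_I2 I" and zero: "(\<lambda>_. 0) \<in> I" and sub: "I \<subseteq> box \<rho>"
  shows "independents \<rho> (rank_of I) = I"
proof (intro equalityI subsetI)
  fix p assume p: "p \<in> independents \<rho> (rank_of I)"
  obtain a where a: "a \<in> I" "a \<le> p" "int (size_in I a) = rank_of I p"
    using rank_of_attained[OF zero] .
  have "a = p"
  proof (rule ccontr)
    assume "a \<noteq> p"
    then obtain i where i: "a i < p i" using a(2) by (metis ext le_funD order_le_imp_less_or_eq)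
    then have "a \<le> p(i := p i - 1)" using a(2) by (auto simp: le_fun_def)
    then have "rank_of I p \<le> rank_of I (p(i := p i - 1))" using a size_le_rank_of by metis
    moreover have "rank_of I (p(i := p i - 1)) = rank_of I p - 1"
      using p i by (auto simp: independents_def)
    ultimately show False by simp
  qed
  then show "p \<in> I" using a by simp
next
  fix p assume p: "p \<in> I"
  have "rank_of I (p(i := p i - 1)) = rank_of I p - 1" if i: "p i \<ge> 1" for i
  proof (rule antisym)
    obtain a where a: "a \<in> I" "a \<le> p(i := p i - 1)" "int (size_in I a) = rank_of I (p(i := p i - 1))"
      using rank_of_attained[OF zero] .
    have "p(i := p i - 1) < p" using i by (auto simp: less_fun_def le_fun_def not_le)
    then have "a < p" using a(2) by (rule order_le_less_trans[rotated])
    then have "size_in I a < size_in I p" using I2 a p by (auto simp: axiom_I2_def)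
    then show "rank_of I (p(i := p i - 1)) \<le> rank_of I p - 1"
      using a(3) rank_of_mem[OF I2 zero p] by simp
    have "p = (p(i := p i - 1))(i := Suc ((p(i := p i - 1)) i))" using i by auto
    then show "rank_of I p - 1 \<le> rank_of I (p(i := p i - 1))"
      using rank_of_unit_step[OF I1 zero, of "p(i := p i - 1)" i] by simp
  qed
  then show "p \<in> independents \<rho> (rank_of I)" using p sub by (auto simp: independents_def)
qed

section \<open>Simple matricubes and the characterization\<close>

lemma axis_point_independent_iff:
  assumes "t \<le> \<rho> i"
  shows "axis_point t i \<in> independents \<rho> r \<longleftrightarrow>
    t = 0 \<or> r (axis_point t i) = r (axis_point (t - 1) i) + 1"
proof -
  have "(axis_point t i)(i := t - 1) = axis_point (t - 1) i" by (auto simp: axis_point_def)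
  moreover have "axis_point t i \<in> box \<rho>" using assms by (auto simp: box_def axis_point_def)
  moreover have "axis_point t i k \<ge> 1 \<longleftrightarrow> k = i \<and> t \<ge> 1" for k by (auto simp: axis_point_def)
  moreover have "axis_point t i i = t" by (simp add: axis_point_def)
  ultimately show ?thesis by (auto simp: independents_def)
qed

lemma simple_iff_axis_points_independent:
  assumes r: "matricube \<rho> r"
  shows "simple_matricube \<rho> r \<longleftrightarrow> (\<forall>i. \<rho> i > 0) \<and> axiom_Istar \<rho> (independents \<rho> r)"
proof -
  have "(\<forall>t\<le>\<rho> i. r (axis_point t i) = int t) \<longleftrightarrow> (\<forall>t\<le>\<rho> i. axis_point t i \<in> independents \<rho> r)" for i
  proof
    assume "\<forall>t\<le>\<rho> i. r (axis_point t i) = int t"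
    then show "\<forall>t\<le>\<rho> i. axis_point t i \<in> independents \<rho> r"
      by (auto simp: axis_point_independent_iff)
  next
    assume ax: "\<forall>t\<le>\<rho> i. axis_point t i \<in> independents \<rho> r"
    have "t \<le> \<rho> i \<Longrightarrow> r (axis_point t i) = int t" for t
    proof (induction t)
      case 0
      have "axis_point 0 i = (\<lambda>_. 0)" by (auto simp: axis_point_def)
      then show ?case using r by (simp add: matricube_def)
    next
      case (Suc t)
      have "axis_point (Suc t) i \<in> independents \<rho> r" using ax Suc.prems by blast
      then show ?case using Suc by (simp add: axis_point_independent_iff)
    qed
    then show "\<forall>t\<le>\<rho> i. r (axis_point t i) = int t" by blast
  qed
  then show ?thesis using r by (auto simp: simple_matricube_def axiom_Istar_def)
qed

theorem theorem5p5:
  fixes \<rho> :: "'n::finite \<Rightarrow> nat"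
  shows "(\<forall>r. matricube \<rho> r \<longrightarrow>
            axiom_I1 (independents \<rho> r) \<and> axiom_I2 (independents \<rho> r)) \<and>
         (\<forall>I. I \<subseteq> box \<rho> \<and> I \<noteq> {} \<and> axiom_I1 I \<and> axiom_I2 I \<longrightarrow>
            (\<exists>r. matricube \<rho> r \<and> independents \<rho> r = I)) \<and>
         (\<forall>r. matricube \<rho> r \<longrightarrow>
            (simple_matricube \<rho> r \<longleftrightarrow>
               (\<forall>i. \<rho> i > 0) \<and> axiom_Istar \<rho> (independents \<rho> r)))"
proof (intro conjI allI impI)
  fix I :: "('n \<Rightarrow> nat) set"
  assume "I \<subseteq> box \<rho> \<and> I \<noteq> {} \<and> axiom_I1 I \<and> axiom_I2 I"
  then show "\<exists>r. matricube \<rho> r \<and> independents \<rho> r = I"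
    using zero_mem_of_I1 matricube_rank_of independents_rank_of by (metis ex_in_conv)
qed (simp_all add: independents_I1 independents_I2 simple_iff_axis_points_independent)

end
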